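(* Let $n\geq 2$ and let $\Omega\subsetneq\mathbb{C}^n$ be a $B$-regular domain. Suppose there exist a sequence $(z_\nu)_{\nu\geq 1}\subset\Omega$, a point $\xi\in\partial\Omega$ such that $z_\nu\to\xi$, and unit vectors $\mathbf{u}_\nu\in T^{(1,0)}_{z_\nu}\Omega\cong\mathbb{C}^n$, $\nu=1,2,3,\dots$, such that $$\lim_{\nu\to\infty}\frac{\mathbf{r}_\Omega(z_\nu;\mathbf{u}_\nu)}{\big(\mathrm{dist}_{Euc}(z_\nu,\partial\Omega)\big)^{\alpha}}=\infty\qquad\text{for all }\alpha\in(0,1].$$ Then there exist functions $\varphi:\partial\Omega\to\mathbb{R}$ that are restrictions to $\partial\Omega$ of $\mathcal{C}^\infty$-smooth functions defined on neighbourhoods of $\partial\Omega$ such that, for every non-negative $f\in\mathcal{C}(\overline\Omega;\mathbb{R})$, the unique solution $u$ to the Dirichlet problem $$(dd^c u)^n=f\beta_n,\quad u\in\mathcal{C}(\overline\Omega)\cap\mathsf{psh}(\Omega),\qquad u|_{\partial\Omega}=\varphi,$$ does not belong to $\mathcal{C}^{0,\alpha}(\overline\Omega)$ for any $\alpha\in(0,1]$.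
   Context: $B$-regular: a bounded domain $\Omega\subset\mathbb{C}^n$ is $B$-regular if every $\varphi\in\mathcal{C}(\partial\Omega;\mathbb{R})$ is the uniform limit on $\partial\Omega$ of a sequence $(u_\nu)_{\nu\ge1}$ of continuous plurisubharmonic functions defined on open neighbourhoods of $\partial\Omega$ (each neighbourhood depending on $u_\nu$). For $z\in\Omega$ and $v\in\mathbb{C}^n$ with $\|v\|=1$ (Euclidean norm), $\mathbf{r}_\Omega(z;v):=\sup\{r>0: z+(r\mathbb{D})v\subset\Omega\}$, where $\mathbb{D}$ is the open unit disc in $\mathbb{C}$ centred at $0$. $\mathrm{dist}_{Euc}(z,\partial\Omega):=\inf\{\|z-\xi\|:\xi\in\partial\Omega\}$. $\mathcal{C}(\overline\Omega)\cap\mathsf{psh}(\Omega)$ is the class of continuous functions $u:\overline\Omega\to\mathbb{R}$ with $u|_\Omega$ plurisubharmonic. $(dd^cu)^n=dd^cu\wedge\dots\wedge dd^cu$ ($n$ factors) is the complex Monge–Ampère operator, understood as a current of bidegree $(n,n)$ in the sense of Bedford–Taylor, with the normalisation $dd^cu=\frac i2\sum_{j,k}\frac{\partial^2u}{\partial z_j\partial\bar z_k}dz_j\wedge d\bar z_k$, and $\beta_n:=(i/2)^n(dz_1\wedge d\bar z_1)\wedge\dots\wedge(dz_n\wedge d\bar z_n)$. It is a known theorem (Błocki) that, on a $B$-regular domain, this Dirichlet problem has a unique solution for every non-negative $f\in\mathcal{C}(\overline\Omega;\mathbb{R})$ and every $\varphi\in\mathcal{C}(\partial\Omega;\mathbb{R})$.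 $\mathcal{C}^{0,\alpha}(S)$ is the class of real-valued functions on $S$ satisfying a Hölder condition with exponent $\alpha\in(0,1]$ (Lipschitz if $\alpha=1$). *)

theory Defs
  imports "HOL-Analysis.Analysis"
begin

section \<open>Function classes\<close>

text \<open>\<open>C\<^sup>k\<close> and \<open>C\<^sup>\<infinity>\<close> on an open set, in the real sense: all derivatives in real directions.\<close>

primrec C_k_on :: "nat \<Rightarrow> 'a::euclidean_space set \<Rightarrow> ('a \<Rightarrow> 'b::real_normed_vector) \<Rightarrow> bool" where
  "C_k_on 0 S f \<longleftrightarrow> continuous_on S f"
| "C_k_on (Suc k) S f \<longleftrightarrow>
     (\<forall>x\<in>S. f differentiable (at x)) \<and> (\<forall>v. C_k_on k S (\<lambda>x. frechet_derivative f (at x) v))"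

definition smooth_on :: "'a::euclidean_space set \<Rightarrow> ('a \<Rightarrow> 'b::real_normed_vector) \<Rightarrow> bool" where
  "smooth_on S f \<longleftrightarrow> (\<forall>k. C_k_on k S f)"

definition holder_on :: "real \<Rightarrow> 'a::metric_space set \<Rightarrow> ('a \<Rightarrow> real) \<Rightarrow> bool" where
  "holder_on \<alpha> S f \<longleftrightarrow> (\<exists>C. \<forall>x\<in>S. \<forall>y\<in>S. \<bar>f x - f y\<bar> \<le> C * dist x y powr \<alpha>)"

text \<open>Plurisubharmonicity, on an open set \<open>U\<close>, of functions that never take the value \<open>-\<infinity>\<close>:
  upper semicontinuity together with the sub-mean-value inequality on every closed disc in a
  complex line. For such functions the circle means are automatically finite, so asking for
  integrability loses nothing; it is there because the integral of a non-integrable function is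
  \<open>0\<close> by convention.\<close>

definition psh_on :: "(complex^'n) set \<Rightarrow> (complex^'n \<Rightarrow> real) \<Rightarrow> bool" where
  "psh_on U u \<longleftrightarrow>
     (\<forall>a\<in>U. \<forall>c > u a. eventually (\<lambda>z. u z < c) (at a within U)) \<and>
     (\<forall>a v. (\<lambda>\<zeta>. a + \<zeta> *s v) ` cball 0 1 \<subseteq> U \<longrightarrow>
        set_integrable lborel {0..2*pi} (\<lambda>t. u (a + cis t *s v)) \<and>
        u a \<le> 1 / (2*pi) * (LINT t:{0..2*pi}|lborel. u (a + cis t *s v)))"

section \<open>Domains\<close>

definition B_regular_domain :: "(complex^'n) set \<Rightarrow> bool" where
  "B_regular_domain \<Omega> \<longleftrightarrow>
     open \<Omega> \<and> connected \<Omega> \<and> \<Omega> \<noteq> {} \<and> bounded \<Omega> \<and>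
     (\<forall>\<phi> :: complex^'n \<Rightarrow> real. continuous_on (frontier \<Omega>) \<phi> \<longrightarrow>
        (\<exists>(N :: nat \<Rightarrow> (complex^'n) set) (u :: nat \<Rightarrow> complex^'n \<Rightarrow> real).
           (\<forall>\<nu>. open (N \<nu>) \<and> frontier \<Omega> \<subseteq> N \<nu> \<and> continuous_on (N \<nu>) (u \<nu>) \<and> psh_on (N \<nu>) (u \<nu>)) \<and>
           uniform_limit (frontier \<Omega>) u \<phi> sequentially))"

definition disc_radius :: "(complex^'n) set \<Rightarrow> complex^'n \<Rightarrow> complex^'n \<Rightarrow> real" where
  "disc_radius \<Omega> z v = Sup {r. r > 0 \<and> (\<lambda>\<zeta>. z + (of_real r * \<zeta>) *s v) ` ball 0 1 \<subseteq> \<Omega>}"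

section \<open>The complex Monge--Ampere operator of Bedford and Taylor\<close>

definition test_function :: "(complex^'n) set \<Rightarrow> (complex^'n \<Rightarrow> complex) \<Rightarrow> bool" where
  "test_function \<Omega> \<theta> \<longleftrightarrow>
     smooth_on UNIV \<theta> \<and> compact (closure {z. \<theta> z \<noteq> 0}) \<and> closure {z. \<theta> z \<noteq> 0} \<subseteq> \<Omega>"

definition wirtinger :: "'n \<Rightarrow> (complex^'n \<Rightarrow> complex) \<Rightarrow> complex^'n \<Rightarrow> complex" where
  "wirtinger j \<theta> z =
     (frechet_derivative \<theta> (at z) (axis j 1) - \<i> * frechet_derivative \<theta> (at z) (axis j \<i>)) / 2"

definition wirtinger_bar :: "'n \<Rightarrow> (complex^'n \<Rightarrow> complex) \<Rightarrow> complex^'n \<Rightarrow> complex" where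
  "wirtinger_bar k \<theta> z =
     (frechet_derivative \<theta> (at z) (axis k 1) + \<i> * frechet_derivative \<theta> (at z) (axis k \<i>)) / 2"

text \<open>Complex Radon measures on the open set \<open>\<Omega>\<close> (equivalently, distributions of order \<open>0\<close>),
  as functionals on \<open>C\<^sub>c(\<Omega>)\<close> that are bounded on functions supported in a fixed compact set.
  Elements of \<open>C\<^sub>c(\<Omega>)\<close> are extended by \<open>0\<close> outside \<open>\<Omega>\<close>.\<close>

definition Cc :: "(complex^'n) set \<Rightarrow> (complex^'n \<Rightarrow> complex) set" where
  "Cc K = {\<psi>. continuous_on UNIV \<psi> \<and> compact (closure {z. \<psi> z \<noteq> 0}) \<and> closure {z. \<psi> z \<noteq> 0} \<subseteq> K}"

definition radon_measure_on :: "(complex^'n) set \<Rightarrow> ((complex^'n \<Rightarrow> complex) \<Rightarrow> complex) \<Rightarrow> bool" where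
  "radon_measure_on \<Omega> m \<longleftrightarrow>
     (\<forall>\<phi>\<in>Cc \<Omega>. \<forall>\<psi>\<in>Cc \<Omega>. m (\<lambda>z. \<phi> z + \<psi> z) = m \<phi> + m \<psi>) \<and>
     (\<forall>c. \<forall>\<psi>\<in>Cc \<Omega>. m (\<lambda>z. c * \<psi> z) = c * m \<psi>) \<and>
     (\<forall>K. compact K \<and> K \<subseteq> \<Omega> \<longrightarrow>
        (\<exists>C. \<forall>\<psi>\<in>Cc K. \<forall>B. (\<forall>z. norm (\<psi> z) \<le> B) \<longrightarrow> norm (m \<psi>) \<le> C * B))"

text \<open>A current \<open>T\<close> of bidegree \<open>(p,p)\<close> is a \<open>(p,p)\<close>-form with distributional coefficients. We
  write it as
    \<open>T = (i/2)\<^sup>p \<Sum> T J K (dz\<^bsub>j1\<^esub> \<and> d\<zeta>\<^bsub>k1\<^esub>) \<and> \<dots> \<and> (dz\<^bsub>jp\<^esub> \<and> d\<zeta>\<^bsub>kp\<^esub>)\<close>,  where \<open>d\<zeta>\<close> denotes the conjugate of \<open>dz\<close>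
  and the sum runs over \<open>J = {j1 < \<dots> < jp}\<close> and \<open>K = {k1 < \<dots> < kp}\<close>; the values
  \<open>T J K\<close> at index sets of any other cardinality are irrelevant. For \<open>p = n\<close> the only basis
  form, with the factor \<open>(i/2)\<^sup>n\<close>, is \<open>\<beta>\<^sub>n\<close>, i.e. Lebesgue measure. The linear order on the
  index type is the ordering of the coordinates \<open>z\<^sub>1, \<dots>, z\<^sub>n\<close>.\<close>

type_synonym 'n current = "'n set \<Rightarrow> 'n set \<Rightarrow> (complex^'n \<Rightarrow> complex) \<Rightarrow> complex"

definition current_order0 :: "(complex^'n) set \<Rightarrow> nat \<Rightarrow> 'n current \<Rightarrow> bool" where
  "current_order0 \<Omega> p T \<longleftrightarrow>
     (\<forall>J K. card J = p \<and> card K = p \<longrightarrow> radon_measure_on \<Omega> (T J K))"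

text \<open>The current \<open>1\<close> of bidegree \<open>(0,0)\<close>, which is the empty product \<open>(dd\<^sup>c u)\<^sup>0\<close>.\<close>

definition unit_current :: "'n::finite current" where
  "unit_current J K \<psi> = (LINT z|lborel. \<psi> z)"

definition mult_current :: "(complex^'n \<Rightarrow> real) \<Rightarrow> 'n current \<Rightarrow> 'n current" where
  "mult_current u T J K \<psi> = T J K (\<lambda>z. of_real (u z) * \<psi> z)"

text \<open>The sign in \<open>dz\<^sub>j \<and> dz\<^bsub>J - {j}\<^esub> = \<epsilon> dz\<^bsub>J\<^esub>\<close>, for \<open>j \<in> J\<close>.\<close>

definition wedge_sign :: "'n::linorder \<Rightarrow> 'n set \<Rightarrow> complex" where
  "wedge_sign j J = (-1) ^ card {i \<in> J. i < j}"

text \<open>\<open>dd\<^sup>c T = (i/2) \<Sum>\<^sub>j\<^sub>,\<^sub>k dz\<^sub>j \<and> d\<zeta>\<^sub>k \<and> \<partial>\<^sub>j \<partial>'\<^sub>k T\<close> (with \<open>\<partial>'\<^sub>k\<close> the derivative in the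
  conjugate variable), the derivatives of the coefficients being taken in the distributional
  sense. Since the two-forms \<open>dz\<^sub>j \<and> d\<zeta>\<^sub>k\<close> commute with each other, sorting a product of them into
  the above basis produces exactly the signs of the two sortings, of the \<open>j\<close>'s and of the
  \<open>k\<close>'s.\<close>

definition ddc :: "'n::{finite,linorder} current \<Rightarrow> 'n current" where
  "ddc T J K \<theta> =
     (\<Sum>j\<in>J. \<Sum>k\<in>K. wedge_sign j J * wedge_sign k K *
        T (J - {j}) (K - {k}) (wirtinger j (wirtinger_bar k \<theta>)))"

text \<open>\<open>ddc_power \<Omega> u p T\<close>: on \<open>\<Omega>\<close>, \<open>T\<close> is the current \<open>(dd\<^sup>c u)\<^sup>p\<close> for a continuous
  plurisubharmonic \<open>u\<close>, by the inductive definition \<open>(dd\<^sup>c u)\<^sup>p\<^sup>+\<^sup>1 = dd\<^sup>c (u (dd\<^sup>c u)\<^sup>p)\<close> of Bedford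
  and Taylor. Each power has measure coefficients, so it can be multiplied by the merely
  continuous function \<open>u\<close>; a measure is determined by its values on test functions.\<close>

primrec ddc_power ::
    "(complex, 'n::{finite,linorder}) vec set \<Rightarrow> ((complex, 'n) vec \<Rightarrow> real) \<Rightarrow> nat \<Rightarrow> 'n current \<Rightarrow> bool"
  where
  "ddc_power \<Omega> u 0 T \<longleftrightarrow> T = unit_current"
| "ddc_power \<Omega> u (Suc p) S \<longleftrightarrow>
    (\<exists>T. ddc_power \<Omega> u p T \<and> current_order0 \<Omega> (Suc p) S \<and>
      (\<forall>J K \<theta>. card J = Suc p \<and> card K = Suc p \<and> test_function \<Omega> \<theta> \<longrightarrow>
         S J K \<theta> = ddc (mult_current u T) J K \<theta>))"

text \<open>The equation \<open>(dd\<^sup>c u)\<^sup>n = f \<beta>\<^sub>n\<close> of currents of bidegree \<open>(n,n)\<close> on \<open>\<Omega>\<close>.\<close>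

definition monge_ampere_eq ::
    "(complex, 'n::{finite,linorder}) vec set \<Rightarrow> ((complex, 'n) vec \<Rightarrow> real) \<Rightarrow> ((complex, 'n) vec \<Rightarrow> real) \<Rightarrow> bool" where
  "monge_ampere_eq \<Omega> u f \<longleftrightarrow>
     (\<exists>T. ddc_power \<Omega> u CARD('n) T \<and>
        (\<forall>\<theta>. test_function \<Omega> \<theta> \<longrightarrow>
           T UNIV UNIV \<theta> = (LINT z:\<Omega>|lborel. of_real (f z) * \<theta> z)))"

definition dirichlet_solution ::
    "(complex, 'n::{finite,linorder}) vec set \<Rightarrow> ((complex, 'n) vec \<Rightarrow> real) \<Rightarrow> ((complex, 'n) vec \<Rightarrow> real) \<Rightarrow>
     ((complex, 'n) vec \<Rightarrow> real) \<Rightarrow> bool" where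
  "dirichlet_solution \<Omega> f \<phi> u \<longleftrightarrow>
     continuous_on (closure \<Omega>) u \<and> psh_on \<Omega> u \<and> monge_ampere_eq \<Omega> u f \<and>
     (\<forall>z\<in>frontier \<Omega>. u z = \<phi> z)"

end

theory Submission
  imports Defs
begin

text \<open>Take \<open>\<phi> = -\<parallel>x\<parallel>\<^sup>2\<close>. For any plurisubharmonic \<open>u\<close> with these boundary values, the function
  \<open>w = u + \<parallel>x\<parallel>\<^sup>2\<close> vanishes on the boundary and satisfies \<open>w a \<le> mean w - s\<^sup>2\<close> for the mean over every
  circle of radius \<open>s\<close> about \<open>a\<close> in a complex line. Hence \<open>w \<le> 0\<close> by the maximum principle, and
  then \<open>w z \<le> -r\<^sup>2\<close>, where \<open>r\<close> is the disc radius at \<open>z\<close>. If \<open>u\<close> were \<open>\<alpha>\<close>-Hoelder, then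
  \<open>-w z \<le> C d\<^sup>\<alpha>\<close> with \<open>d\<close> the distance of \<open>z\<close> to the boundary, so \<open>r \<le> C' d\<^bsup>\<alpha>/2\<^esup>\<close>.\<close>

lemma C_k_on_const: "C_k_on k S (\<lambda>x. c)"
  by (induction k arbitrary: c) auto

lemma smooth_on_const: "smooth_on S (\<lambda>x. c)"
  by (simp add: smooth_on_def C_k_on_const)

text \<open>One unfolding replaces an induction on the order: \<open>C_k_on (Suc k)\<close> asks for
  \<open>C_k_on k\<close> of the directional derivatives, which their smoothness supplies. The
  derivative is given at every point, so that \<open>frechet_derivative f (at x)\<close> rewrites to
  \<open>f' x\<close> under the lambda.\<close>

lemma smooth_onI:
  assumes D: "\<And>x. (f has_derivative f' x) (at x)"
    and S: "\<And>v. smooth_on S (\<lambda>x. f' x v)"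
  shows "smooth_on S f"
  unfolding smooth_on_def
proof
  fix k
  have "frechet_derivative f (at x) = f' x" for x
    using frechet_derivative_at[OF D] by simp
  moreover have "f differentiable (at x)" for x
    using D differentiable_def by blast
  moreover have "continuous_on S f"
    using D has_derivative_continuous continuous_at_imp_continuous_on by blast
  ultimately show "C_k_on k S f"
    using S by (cases k) (auto simp: smooth_on_def)
qed

lemma smooth_on_bounded_linear:
  assumes "bounded_linear f"
  shows "smooth_on S f"
  by (rule smooth_onI[OF bounded_linear_imp_has_derivative[OF assms] smooth_on_const])

lemma smooth_on_minus_norm_squared:
  "smooth_on S (\<lambda>x::'a::euclidean_space. - (norm x)\<^sup>2)"
proof (rule smooth_onI)
  show "((\<lambda>x. - (norm x)\<^sup>2) has_derivative (\<lambda>h. - 2 * (x \<bullet> h))) (at x)" for x :: 'a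
    unfolding power2_norm_eq_inner
    by (auto intro!: derivative_eq_intros simp: inner_commute)
  show "smooth_on S (\<lambda>x. - 2 * (x \<bullet> v))" for v :: 'a
    by (intro smooth_on_bounded_linear bounded_linear_const_mult bounded_linear_inner_left)
qed

lemma norm_vector_scalar_mult: "norm (c *s v) = norm c * norm (v :: complex^'n)"
  by (simp add: norm_vec_def L2_set_def norm_mult power_mult_distrib flip: sum_distrib_left)
    (simp add: real_sqrt_mult)

text \<open>Real-linear expansion of cis t = cos t + i sin t. It turns the cross term of the squared
  norm on a circle into a trigonometric polynomial without constant term.\<close>

lemma inner_cis_scalar_mult:
  fixes a v :: "complex^'n"
  shows "a \<bullet> (cis t *s v) = (a \<bullet> v) * cos t + (a \<bullet> (\<i> *s v)) * sin t"
  unfolding inner_vec_def sum_distrib_right sum.distrib[symmetric]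
  by (rule sum.cong) (auto simp: inner_complex_def algebra_simps)

lemma norm_circle_point_squared:
  fixes a v :: "complex^'n"
  shows "(norm (a + cis t *s v))\<^sup>2
    = (norm a)\<^sup>2 + (norm v)\<^sup>2 + 2 * ((a \<bullet> v) * cos t + (a \<bullet> (\<i> *s v)) * sin t)"
proof -
  have "(norm (a + cis t *s v))\<^sup>2
      = (norm a)\<^sup>2 + (norm (cis t *s v))\<^sup>2 + 2 * (a \<bullet> (cis t *s v))"
    by (simp add: power2_norm_eq_inner inner_add_left inner_add_right inner_commute)
  then show ?thesis
    by (simp add: norm_vector_scalar_mult inner_cis_scalar_mult)
qed

lemma has_integral_norm_circle_point_squared:
  fixes a v :: "complex^'n"
  shows "((\<lambda>t. M - (norm (a + cis t *s v))\<^sup>2) has_integral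
           2 * pi * (M - (norm a)\<^sup>2 - (norm v)\<^sup>2)) {0..2*pi}"
proof -
  \<comment> \<open>The trigonometric part of this antiderivative has period 2 pi, so it drops out
    of the difference of the end values.\<close>
  let ?F = "\<lambda>t. (M - (norm a)\<^sup>2 - (norm v)\<^sup>2) * t
    - 2 * ((a \<bullet> v) * sin t - (a \<bullet> (\<i> *s v)) * cos t)"
  have "((\<lambda>t. M - (norm (a + cis t *s v))\<^sup>2) has_integral ?F (2*pi) - ?F 0) {0..2*pi}"
    unfolding norm_circle_point_squared
    by (rule fundamental_theorem_of_calculus)
      (auto intro!: derivative_eq_intros simp flip: has_real_derivative_iff_has_vector_derivative)
  then show ?thesis
    by (simp add: algebra_simps)
qed

text \<open>On the circle u is at most \<open>M\<close> minus the squared norm, and the mean of the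
  squared norm exceeds its value at the centre by exactly the squared radius. This gain serves
  twice: with \<open>M\<close> the maximum it gives the maximum principle, with \<open>M\<close> = 0
  the bound on disc radii.\<close>

lemma psh_on_plus_norm_squared_le:
  fixes a v :: "complex^'n"
  assumes "psh_on U u" and D: "(\<lambda>\<zeta>. a + \<zeta> *s v) ` cball 0 1 \<subseteq> U"
    and M: "\<And>x. x \<in> U \<Longrightarrow> u x + (norm x)\<^sup>2 \<le> M"
  shows "u a + (norm a)\<^sup>2 \<le> M - (norm v)\<^sup>2"
proof -
  have int: "set_integrable lborel {0..2*pi} (\<lambda>t. u (a + cis t *s v))"
    and le: "u a \<le> 1 / (2*pi) * (LINT t:{0..2*pi}|lborel. u (a + cis t *s v))"
    using assms(1) D unfolding psh_on_def by blast+
  have "((\<lambda>t. u (a + cis t *s v)) has_integral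
      (LINT t:{0..2*pi}|lborel. u (a + cis t *s v))) {0..2*pi}"
    using set_borel_integral_eq_integral[OF int] by (simp add: has_integral_iff)
  moreover have "u (a + cis t *s v) \<le> M - (norm (a + cis t *s v))\<^sup>2" for t
  proof -
    have "a + cis t *s v \<in> U"
      by (rule subsetD[OF D]) (simp add: image_eqI[of _ _ "cis t"])
    then show ?thesis using M by fastforce
  qed
  ultimately have "(LINT t:{0..2*pi}|lborel. u (a + cis t *s v))
      \<le> 2 * pi * (M - (norm a)\<^sup>2 - (norm v)\<^sup>2)"
    by (intro has_integral_le[OF _ has_integral_norm_circle_point_squared])
  then have "1 / (2*pi) * (LINT t:{0..2*pi}|lborel. u (a + cis t *s v))
      \<le> M - (norm a)\<^sup>2 - (norm v)\<^sup>2"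
    by (simp add: field_simps)
  with le show ?thesis by linarith
qed

lemma psh_on_plus_norm_squared_nonpos:
  fixes \<Omega> :: "(complex^'n) set"
  assumes "open \<Omega>" "bounded \<Omega>" "psh_on \<Omega> u" "continuous_on (closure \<Omega>) u"
    and bd: "\<And>x. x \<in> frontier \<Omega> \<Longrightarrow> u x = - (norm x)\<^sup>2"
    and "x \<in> \<Omega>"
  shows "u x + (norm x)\<^sup>2 \<le> 0"
proof -
  let ?w = "\<lambda>x. u x + (norm x)\<^sup>2"
  have "compact (closure \<Omega>)" "closure \<Omega> \<noteq> {}"
    using assms by (auto simp: compact_closure)
  moreover have "continuous_on (closure \<Omega>) ?w"
    by (intro continuous_intros assms)
  ultimately obtain m where m: "m \<in> closure \<Omega>" and max: "\<And>y. y \<in> closure \<Omega> \<Longrightarrow> ?w y \<le> ?w m"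
    using continuous_attains_sup[of "closure \<Omega>" ?w] by blast
  have "m \<notin> \<Omega>"
  proof
    assume "m \<in> \<Omega>"
    then obtain e where e: "e > 0" "cball m e \<subseteq> \<Omega>"
      using \<open>open \<Omega>\<close> open_contains_cball by blast
    \<comment> \<open>Any complex line through \<open>m\<close> will do: a disc of positive radius
      already gives a strict gain, which is impossible at a maximum.\<close>
    obtain b :: "complex^'n" where b: "norm b = e"
      using vector_choose_size[of e] e by auto
    have "(\<lambda>\<zeta>. m + \<zeta> *s b) ` cball 0 1 \<subseteq> \<Omega>"
    proof (intro image_subsetI subsetD[OF e(2)])
      fix \<zeta> :: complex assume "\<zeta> \<in> cball 0 1"
      then show "m + \<zeta> *s b \<in> cball m e"
        using e b by (simp add: dist_norm norm_vector_scalar_mult mult_left_le_one_le)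
    qed
    then have "?w m \<le> ?w m - (norm b)\<^sup>2"
      using psh_on_plus_norm_squared_le[OF assms(3)] max closure_subset by blast
    with b e show False by simp
  qed
  with m \<open>open \<Omega>\<close> have "?w m = 0"
    using bd by (simp add: frontier_def interior_open)
  moreover have "?w x \<le> ?w m"
    using max \<open>x \<in> \<Omega>\<close> closure_subset by blast
  ultimately show ?thesis by simp
qed

text \<open>Every closed disc of radius s about z inside \<Omega> forces u z + |z|^2 \<le> -s^2, by
  the gain with \<open>M\<close> = 0.\<close>

lemma disc_radius_le:
  fixes \<Omega> :: "(complex^'n) set"
  assumes "open \<Omega>" "z \<in> \<Omega>" "norm v = 1" "psh_on \<Omega> u"
    and nonpos: "\<And>x. x \<in> \<Omega> \<Longrightarrow> u x + (norm x)\<^sup>2 \<le> 0"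
  shows "disc_radius \<Omega> z v \<le> sqrt (- (u z + (norm z)\<^sup>2))"
  unfolding disc_radius_def
proof (rule cSup_least)
  \<comment> \<open>The set of radii must be nonempty, because \<open>Sup {}\<close> is unspecified
    on the reals.\<close>
  obtain e where e: "e > 0" "ball z e \<subseteq> \<Omega>"
    using assms open_contains_ball by metis
  have "(\<lambda>\<zeta>. z + (of_real e * \<zeta>) *s v) ` ball 0 1 \<subseteq> \<Omega>"
  proof (intro image_subsetI subsetD[OF e(2)])
    fix \<zeta> :: complex assume "\<zeta> \<in> ball 0 1"
    then show "z + (of_real e * \<zeta>) *s v \<in> ball z e"
      using e assms by (simp add: dist_norm norm_vector_scalar_mult norm_mult)
  qed
  with e show "{r. r > 0 \<and> (\<lambda>\<zeta>. z + (of_real r * \<zeta>) *s v) ` ball 0 1 \<subseteq> \<Omega>} \<noteq> {}"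
    by blast
next
  fix r assume "r \<in> {r. r > 0 \<and> (\<lambda>\<zeta>. z + (of_real r * \<zeta>) *s v) ` ball 0 1 \<subseteq> \<Omega>}"
  then have r: "r > 0" and D: "\<And>\<zeta>. norm \<zeta> < 1 \<Longrightarrow> z + (of_real r * \<zeta>) *s v \<in> \<Omega>"
    by (auto simp: image_subset_iff)
  show "r \<le> sqrt (- (u z + (norm z)\<^sup>2))"
  \<comment> \<open>The radius is defined by open discs, the sub-mean-value inequality by closed
    ones, so the estimate is made for s < r and passed to the limit.\<close>
  proof (rule dense_le_bounded[OF r])
    fix s assume s: "0 < s" "s < r"
    have "(\<lambda>\<zeta>. z + \<zeta> *s (of_real s *s v)) ` cball 0 1 \<subseteq> \<Omega>"
    proof (intro image_subsetI)
      fix \<zeta> :: complex assume "\<zeta> \<in> cball 0 1"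
      then have "s * norm \<zeta> < r"
        using s by (smt (verit) mem_cball_0 mult_left_le)
      with s have "norm (of_real (s / r) * \<zeta>) < 1"
        by (simp add: norm_mult norm_divide)
      from D[OF this] show "z + \<zeta> *s (of_real s *s v) \<in> \<Omega>"
        using r by (simp add: vector_smult_assoc mult.commute)
    qed
    from psh_on_plus_norm_squared_le[OF assms(4) this nonpos]
    have "s\<^sup>2 \<le> - (u z + (norm z)\<^sup>2)"
      using assms s by (simp add: norm_vector_scalar_mult)
    then show "s \<le> sqrt (- (u z + (norm z)\<^sup>2))"
      by (rule real_le_rsqrt)
  qed
qed

text \<open>At a nearest boundary point p the function u + |x|^2 vanishes, so its negative at x
  equals (u p - u x) + (|p|^2 - |x|^2): a Hoelder difference plus a Lipschitz one.\<close>

lemma holder_on_imp_minus_le_infdist: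
  fixes \<Omega> :: "'a::euclidean_space set"
  assumes "bounded \<Omega>" "frontier \<Omega> \<noteq> {}" "holder_on \<alpha> (closure \<Omega>) u"
    and \<alpha>: "0 < \<alpha>" "\<alpha> \<le> 1"
    and bd: "\<And>x. x \<in> frontier \<Omega> \<Longrightarrow> u x = - (norm x)\<^sup>2"
  obtains C where "\<And>x. x \<in> \<Omega> \<Longrightarrow> infdist x (frontier \<Omega>) \<le> 1 \<Longrightarrow>
    - (u x + (norm x)\<^sup>2) \<le> C * infdist x (frontier \<Omega>) powr \<alpha>"
proof -
  obtain A where A: "\<And>x y. x \<in> closure \<Omega> \<Longrightarrow> y \<in> closure \<Omega> \<Longrightarrow> \<bar>u x - u y\<bar> \<le> A * dist x y powr \<alpha>"
    using assms(3) unfolding holder_on_def by blast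
  obtain B where B: "B > 0" "\<And>x. x \<in> closure \<Omega> \<Longrightarrow> norm x \<le> B"
    using bounded_closure[OF assms(1)] bounded_pos by metis
  show ?thesis
  proof (rule that[of "A + 2 * B"])
    fix x assume x: "x \<in> \<Omega>" and le1: "infdist x (frontier \<Omega>) \<le> 1"
    obtain p where p: "p \<in> frontier \<Omega>" and d: "infdist x (frontier \<Omega>) = dist x p"
      using infdist_attains_inf[OF frontier_closed assms(2)] by metis
    have cl: "x \<in> closure \<Omega>" "p \<in> closure \<Omega>"
      using x p closure_subset by (auto simp: frontier_def)
    have "(norm p)\<^sup>2 - (norm x)\<^sup>2 = (norm p - norm x) * (norm p + norm x)"
      by (simp add: power2_eq_square algebra_simps)
    also have "\<dots> \<le> dist x p * (2 * B)"
      using B(2)[OF cl(1)] B(2)[OF cl(2)] norm_triangle_ineq2[of p x]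
      by (intro mult_mono) (auto simp: dist_norm norm_minus_commute)
    \<comment> \<open>Distance at most 1 and exponent at most 1 let the Lipschitz term be absorbed
      into the Hoelder term.\<close>
    also have "dist x p \<le> dist x p powr \<alpha>"
      using powr_mono'[of \<alpha> 1 "dist x p"] \<alpha> le1 d by simp
    finally have "(norm p)\<^sup>2 - (norm x)\<^sup>2 \<le> dist x p powr \<alpha> * (2 * B)"
      using B by simp
    moreover have "u p - u x \<le> A * dist x p powr \<alpha>"
      using A[OF cl] by linarith
    ultimately show "- (u x + (norm x)\<^sup>2) \<le> (A + 2 * B) * infdist x (frontier \<Omega>) powr \<alpha>"
      using bd[OF p] d by (simp add: algebra_simps)
  qed
qed

theorem theorem1p1:
  fixes \<Omega> :: "(complex, 'n::{finite,linorder}) vec set"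
    and z :: "nat \<Rightarrow> (complex, 'n) vec"
    and v :: "nat \<Rightarrow> (complex, 'n) vec"
    and \<xi> :: "(complex, 'n) vec"
  assumes "CARD('n) \<ge> 2"
    and "\<Omega> \<subset> UNIV"
    and "B_regular_domain \<Omega>"
    and "\<And>\<nu>. z \<nu> \<in> \<Omega>"
    and "\<xi> \<in> frontier \<Omega>"
    and "z \<longlonglongrightarrow> \<xi>"
    and "\<And>\<nu>. norm (v \<nu>) = 1"
    and "\<And>\<alpha>. \<alpha> \<in> {0<..1} \<Longrightarrow>
      filterlim (\<lambda>\<nu>. disc_radius \<Omega> (z \<nu>) (v \<nu>) / infdist (z \<nu>) (frontier \<Omega>) powr \<alpha>) at_top sequentially"
  shows "\<exists>\<phi> :: (complex, 'n) vec \<Rightarrow> real.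
    (\<exists>U \<Phi>. open U \<and> frontier \<Omega> \<subseteq> U \<and> smooth_on U \<Phi> \<and> (\<forall>x\<in>frontier \<Omega>. \<phi> x = \<Phi> x)) \<and>
    (\<forall>f. continuous_on (closure \<Omega>) f \<and> (\<forall>x\<in>closure \<Omega>. f x \<ge> 0) \<longrightarrow>
      (\<forall>u. dirichlet_solution \<Omega> f \<phi> u \<longrightarrow>
        (\<forall>\<alpha>\<in>{0<..1}. \<not> holder_on \<alpha> (closure \<Omega>) u)))"
proof -
  have \<Omega>: "open \<Omega>" "bounded \<Omega>"
    using assms(3) by (auto simp: B_regular_domain_def)
  have False
    if u: "continuous_on (closure \<Omega>) u" "psh_on \<Omega> u" "\<And>x. x \<in> frontier \<Omega> \<Longrightarrow> u x = - (norm x)\<^sup>2"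
      and \<alpha>: "0 < \<alpha>" "\<alpha> \<le> 1" and h: "holder_on \<alpha> (closure \<Omega>) u" for u \<alpha>
  proof -
    let ?d = "\<lambda>\<nu>. infdist (z \<nu>) (frontier \<Omega>)"
    have nonpos: "u x + (norm x)\<^sup>2 \<le> 0" if "x \<in> \<Omega>" for x
      using psh_on_plus_norm_squared_nonpos[OF \<Omega> u(2,1,3) that] by blast
    have ne: "frontier \<Omega> \<noteq> {}"
      using assms(5) by blast
    obtain C where C: "\<And>x. x \<in> \<Omega> \<Longrightarrow> infdist x (frontier \<Omega>) \<le> 1 \<Longrightarrow>
        - (u x + (norm x)\<^sup>2) \<le> C * infdist x (frontier \<Omega>) powr \<alpha>"
      using holder_on_imp_minus_le_infdist[OF \<Omega>(2) ne h \<alpha> u(3)] by blast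
    \<comment> \<open>The exponent is halved because the disc radius is controlled by a square root;
      \<alpha>/2 still lies in (0,1].\<close>
    have bound: "disc_radius \<Omega> (z \<nu>) (v \<nu>) / ?d \<nu> powr (\<alpha>/2) \<le> sqrt C" if "?d \<nu> \<le> 1" for \<nu>
    proof -
      have "z \<nu> \<notin> frontier \<Omega>"
        using assms(4) \<Omega> by (simp add: frontier_def interior_open)
      then have pos: "?d \<nu> > 0"
        using infdist_pos_not_in_closed[OF frontier_closed ne] by blast
      have "disc_radius \<Omega> (z \<nu>) (v \<nu>) \<le> sqrt (- (u (z \<nu>) + (norm (z \<nu>))\<^sup>2))"
        by (rule disc_radius_le[OF \<Omega>(1) assms(4,7) u(2) nonpos])
      also have "\<dots> \<le> sqrt (C * ?d \<nu> powr \<alpha>)"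
        using C[OF assms(4) that] by simp
      \<comment> \<open>\<open>sqrt\<close> is odd and multiplicative on all reals, so the sign of
        \<open>C\<close> does not matter.\<close>
      also have "\<dots> = sqrt C * ?d \<nu> powr (\<alpha>/2)"
        by (simp add: real_sqrt_mult powr_half_sqrt_powr infdist_nonneg)
      finally show ?thesis
        using pos by (simp add: divide_le_eq)
    qed
    have "\<forall>\<^sub>F \<nu> in sequentially. dist (z \<nu>) \<xi> < 1"
      using assms(6) tendstoD by fastforce
    then have "\<forall>\<^sub>F \<nu> in sequentially. ?d \<nu> \<le> 1"
      by eventually_elim (use infdist_le[OF assms(5)] in \<open>fastforce intro: order_trans less_imp_le\<close>)
    \<comment> \<open>Divergence of the quotient at exponent \<alpha>/2 contradicts
      \<open>bound\<close> once the points are within distance 1 of the boundary.\<close>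
    moreover have "\<forall>\<^sub>F \<nu> in sequentially.
        sqrt C < disc_radius \<Omega> (z \<nu>) (v \<nu>) / ?d \<nu> powr (\<alpha>/2)"
      using assms(8)[of "\<alpha>/2"] \<alpha> by (simp add: filterlim_at_top_dense)
    ultimately have "\<forall>\<^sub>F \<nu> in sequentially. False"
      by eventually_elim (use bound in fastforce)
    then show False by simp
  qed
  then have "\<not> holder_on \<alpha> (closure \<Omega>) u"
    if "dirichlet_solution \<Omega> f (\<lambda>x. - (norm x)\<^sup>2) u" "\<alpha> \<in> {0<..1}" for f u \<alpha>
    using that unfolding dirichlet_solution_def by fastforce
  then show ?thesis
    by (intro exI[of _ "\<lambda>x. - (norm x)\<^sup>2"] conjI exI[of _ UNIV])
      (auto simp: smooth_on_minus_norm_squared)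
qed

end
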